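(* Let $d\in\{1,2\}$, $\varepsilon\ge0$ and $\Delta t>0$. Let $\hat\mu^{1}_{\varepsilon}$, $\hat\mu^{2}_{\varepsilon}$ be two solutions, with initial data in $L^2(\mathbb{R}^d)$ and the same source term $\hat g$, given by $$\hat\mu^{m}_{\boldsymbol\kappa,\varepsilon}(t)=\hat\mu^{m}_{\boldsymbol\kappa,\varepsilon}(0)e^{i\omega_{\boldsymbol\kappa,\varepsilon}t}-\int_0^te^{i\omega_{\boldsymbol\kappa,\varepsilon}(t-\tau)}\hat g_{\boldsymbol\kappa}(\tau)\,d\tau\qquad(m=1,2),$$ and let $\tilde\mu_{\boldsymbol\kappa,\varepsilon}(t)=\hat\mu^{1}_{\boldsymbol\kappa,\varepsilon}(t)-\hat\mu^{2}_{\boldsymbol\kappa,\varepsilon}(t)$. Let $\hat\mu^{m,(k)}_{\boldsymbol\kappa,\varepsilon}$ be the sequences computed by the exponential integrator, $\hat\mu^{m,(0)}_{\boldsymbol\kappa,\varepsilon}=\hat\mu^m_{\boldsymbol\kappa,\varepsilon}(0)$ and $$\hat\mu^{m,(k+1)}_{\boldsymbol\kappa,\varepsilon}=e^{i\omega_{\boldsymbol\kappa,\varepsilon}\Delta t}\left(\hat\mu^{m,(k)}_{\boldsymbol\kappa,\varepsilon}-\mathcal Q_{\boldsymbol\kappa,\Delta t}(k\Delta t)\right),\qquad k\in\mathbb{N},$$ where $\mathcal Q_{\boldsymbol\kappa,\Delta t}(k\Delta t)$ is the value given by any quadrature rule for $\int_0^{\Delta t}e^{-i\omega_{\boldsymbol\kappa,\varepsilon}\tau}\hat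 g_{\boldsymbol\kappa}(\tau+k\Delta t)\,d\tau$ (the same for $m=1,2$), and let $\tilde\mu^{(k)}_{\boldsymbol\kappa,\varepsilon}=\hat\mu^{1,(k)}_{\boldsymbol\kappa,\varepsilon}-\hat\mu^{2,(k)}_{\boldsymbol\kappa,\varepsilon}$. Then, in continuous time, $\tilde\mu_{\boldsymbol\kappa,\varepsilon}(t)=e^{i\omega_{\boldsymbol\kappa,\varepsilon}t}\tilde\mu_{\boldsymbol\kappa,\varepsilon}(0)$, so that $$\|\tilde\mu_\varepsilon(t)\|_{L^2}=e^{-\varepsilon t}\|\tilde\mu_\varepsilon(0)\|_{L^2},\qquad \arg\left(\tilde\mu_{\boldsymbol\kappa,\varepsilon}(t)\right)=\omega_{\boldsymbol\kappa}t,$$ and, in discrete time, $\tilde\mu^{(k+1)}_{\boldsymbol\kappa,\varepsilon}=e^{i\omega_{\boldsymbol\kappa,\varepsilon}\Delta t}\tilde\mu^{(k)}_{\boldsymbol\kappa,\varepsilon}$ for all $k\in\mathbb{N}$, so that, whatever the quadrature rule, $$\|\tilde\mu^{(k)}_\varepsilon\|_{L^2}=e^{-\varepsilon k\Delta t}\|\tilde\mu_\varepsilon(0)\|_{L^2},\qquad \arg\left(\tilde\mu^{(k)}_{\boldsymbol\kappa,\varepsilon}\right)=\omega_{\boldsymbol\kappa}k\Delta t.$$ That is, the exponential integrator treats the dissipation and dispersion of errors initially introduced in $\tilde\mu_{\boldsymbol\kappa,\varepsilon}(0)$ in the same way as the continuous equation.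
   Context: Constants: $0<\rho_1<\rho_2$, $h_1,h_2>0$, $g>0$ (gravitational acceleration); $|\cdot|_2$ is the Euclidean norm; the $L^2$ norm is over $\boldsymbol\kappa\in\mathbb{R}^d$. For $\boldsymbol\kappa\ne0$, $$T_{j,\boldsymbol\kappa}=\rho_j\coth(2\pi|\boldsymbol\kappa|_2h_j)\ (j=1,2),\qquad \omega_{\boldsymbol\kappa}=\sqrt{\frac{2\pi|\boldsymbol\kappa|_2(\rho_2-\rho_1)g}{T_{1,\boldsymbol\kappa}+T_{2,\boldsymbol\kappa}}},\qquad \omega_{\boldsymbol\kappa,\varepsilon}=\omega_{\boldsymbol\kappa}+i\varepsilon .$$ The source term is $$\hat g_{\boldsymbol\kappa}(t)=\frac{2\pi\rho_1\, i\,\boldsymbol\kappa\cdot\boldsymbol U(t)\,e^{-2\pi i\boldsymbol\kappa\cdot X(t)}\hat f_{\boldsymbol\kappa}}{\sinh(2\pi|\boldsymbol\kappa|_2h_1)(T_{1,\boldsymbol\kappa}+T_{2,\boldsymbol\kappa})},$$ where $\boldsymbol U$ is the given ship velocity (integrable in time on bounded intervals, with values in $\mathbb{R}^d$), $X(t)=\int_0^t\boldsymbol U(s)ds$, $f\in L^2(\mathbb{R}^d)$ is the ship shape and $\hat f_{\boldsymbol\kappa}=\int_{\mathbb{R}^d}f(\boldsymbol x)e^{-2\pi i\boldsymbol\kappa\cdot\boldsymbol x}d\boldsymbol x$ (extended to $L^2$). The first identity is read as saying that an error initially introduced goes to zero when $t$ increases; the argument identity is read as prescribing how each frequency component evolv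es.
   Formalization: The argument identities are stated modulo 2π with the initial argument arg(μ̃(0)) added on the right, at frequencies where the initial error is nonzero; as displayed they fail when the initial error has nonzero argument (at t=0) and are undefined where it vanishes. *)

theory Defs
  imports "HOL-Analysis.Analysis" "HOL-Library.Real_Mod"
begin

definition L2_fun :: "('a::euclidean_space \<Rightarrow> complex) \<Rightarrow> bool" where
  "L2_fun u \<longleftrightarrow> u \<in> borel_measurable lebesgue \<and> integrable lebesgue (\<lambda>x. (cmod (u x))\<^sup>2)"

(* Only meaningful for functions satisfying L2_fun: the Bochner integral of a
   non-integrable function is 0. *)
definition L2_norm :: "('a::euclidean_space \<Rightarrow> complex) \<Rightarrow> real" where
  "L2_norm u = sqrt (\<integral>x. (cmod (u x))\<^sup>2 \<partial>lebesgue)"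

definition truncated_fourier :: "('a::euclidean_space \<Rightarrow> complex) \<Rightarrow> real \<Rightarrow> 'a \<Rightarrow> complex" where
  "truncated_fourier f r \<kappa> =
     set_lebesgue_integral lebesgue (cball 0 r)
       (\<lambda>x. f x * exp (- 2 * complex_of_real pi * \<i> * complex_of_real (\<kappa> \<bullet> x)))"

(* F represents the L2 Fourier transform of f, i.e. the extension of the
   integral formula to L2: the limit in L2 of the transforms of the truncations of f to
   balls, which are integrable when f is in L2.  The norm is taken as a nonnegative
   integral, so that non-integrability of the difference cannot pass for convergence. *)
definition is_L2_fourier :: "('a::euclidean_space \<Rightarrow> complex) \<Rightarrow> ('a \<Rightarrow> complex) \<Rightarrow> bool" where
  "is_L2_fourier f F \<longleftrightarrow> L2_fun F \<and>
     ((\<lambda>r. \<integral>\<^sup>+\<kappa>. ennreal ((cmod (truncated_fourier f r \<kappa> - F \<kappa>))\<^sup>2) \<partial>lebesgue) \<longlongrightarrow> 0) at_top"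

definition coth :: "real \<Rightarrow> real" where
  "coth x = cosh x / sinh x"

definition T_coeff :: "real \<Rightarrow> real \<Rightarrow> 'a::euclidean_space \<Rightarrow> real" where
  "T_coeff \<rho> h \<kappa> = \<rho> * coth (2 * pi * norm \<kappa> * h)"

definition omega :: "real \<Rightarrow> real \<Rightarrow> real \<Rightarrow> real \<Rightarrow> real \<Rightarrow> 'a::euclidean_space \<Rightarrow> real" where
  "omega grav \<rho>1 \<rho>2 h1 h2 \<kappa> =
     sqrt (2 * pi * norm \<kappa> * (\<rho>2 - \<rho>1) * grav / (T_coeff \<rho>1 h1 \<kappa> + T_coeff \<rho>2 h2 \<kappa>))"

definition omega_eps ::
  "real \<Rightarrow> real \<Rightarrow> real \<Rightarrow> real \<Rightarrow> real \<Rightarrow> real \<Rightarrow> 'a::euclidean_space \<Rightarrow> complex" where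
  "omega_eps grav \<rho>1 \<rho>2 h1 h2 \<epsilon> \<kappa> =
     complex_of_real (omega grav \<rho>1 \<rho>2 h1 h2 \<kappa>) + \<i> * complex_of_real \<epsilon>"

definition ship_path :: "(real \<Rightarrow> 'a::euclidean_space) \<Rightarrow> real \<Rightarrow> 'a" where
  "ship_path U t = set_lebesgue_integral lebesgue {0..t} U"

(* F is the Fourier transform of the ship shape. *)
definition source_hat ::
  "real \<Rightarrow> real \<Rightarrow> real \<Rightarrow> real \<Rightarrow> (real \<Rightarrow> 'a::euclidean_space) \<Rightarrow> ('a \<Rightarrow> complex) \<Rightarrow> 'a \<Rightarrow> real \<Rightarrow> complex"
where
  "source_hat \<rho>1 \<rho>2 h1 h2 U F \<kappa> t =
     2 * complex_of_real pi * complex_of_real \<rho>1 * \<i> * complex_of_real (\<kappa> \<bullet> U t)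
       * exp (- 2 * complex_of_real pi * \<i> * complex_of_real (\<kappa> \<bullet> ship_path U t)) * F \<kappa>
     / complex_of_real (sinh (2 * pi * norm \<kappa> * h1) * (T_coeff \<rho>1 h1 \<kappa> + T_coeff \<rho>2 h2 \<kappa>))"

(* An arbitrary rule assigning a value to an integrand on [a, b].  No linearity or
   exactness is required, so that interpolatory, composite, Filon-type and adaptive rules
   are all included; weighted_sum_quadrature covers the classical ones. *)
definition quadrature_rule :: "real \<Rightarrow> real \<Rightarrow> ((real \<Rightarrow> complex) \<Rightarrow> complex) \<Rightarrow> bool" where
  "quadrature_rule a b Q \<longleftrightarrow> (\<forall>\<phi> \<psi>. (\<forall>\<tau>\<in>{a..b}. \<phi> \<tau> = \<psi> \<tau>) \<longrightarrow> Q \<phi> = Q \<psi>)"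

lemma weighted_sum_quadrature:
  fixes c :: "'i \<Rightarrow> real" and w :: "'i \<Rightarrow> complex"
  assumes "\<And>j. j \<in> J \<Longrightarrow> c j \<in> {a..b}"
  shows "quadrature_rule a b (\<lambda>\<phi>. \<Sum>j\<in>J. w j * \<phi> (c j))"
  unfolding quadrature_rule_def using assms by (auto intro!: sum.cong)

end

theory Submission
  imports Defs
begin

text \<open>Both solutions carry the same source (respectively quadrature) term, so it cancels in the
  difference, which is then multiplied by \<open>exp (\<i> * \<omega>\<epsilon> \<kappa> * t)\<close>. The modulus of this factor is
  independent of \<open>\<kappa>\<close>. The frequency \<open>\<kappa> = 0\<close>, at which nothing is prescribed, is a null set.\<close>

text \<open>\<open>Arg\<close> is a principal value, so adding \<open>Im c\<close> to it is correct
  only up to a multiple of \<open>2 * pi\<close>. Two polar forms of \<open>exp c * z\<close> have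
  the same nonzero modulus; cancelling it leaves two unit exponentials, whose exponents differ by a
  multiple of \<open>2 * pi * \<i>\<close>.\<close>

lemma rcong_Arg_exp_mult:
  assumes "z \<noteq> 0"
  shows "[Arg (exp c * z) = Arg z + Im c] (rmod (2 * pi))"
proof -
  have "complex_of_real (norm (exp c * z)) * exp (\<i> * Arg (exp c * z)) = exp c * z"
    using assms by (metis Arg_eq exp_not_eq_zero mult_eq_0_iff)
  also have "\<dots> = exp c * (norm z * exp (\<i> * Arg z))"
    using assms by (metis Arg_eq)
  also have "\<dots> = complex_of_real (norm (exp c * z)) * exp (\<i> * (Arg z + Im c))"
    by (simp add: norm_mult exp_eq_polar[of c] cis_conv_exp exp_add distrib_left)
  finally have "exp (\<i> * Arg (exp c * z)) = exp (\<i> * (Arg z + Im c))"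
    using assms by simp
  then obtain n :: int where "Arg (exp c * z) = Arg z + Im c + of_int (2 * n) * pi"
    unfolding exp_eq by (auto simp: complex_eq_iff)
  then show ?thesis
    by (intro rcong_sym[OF rcong_altdef[THEN iffD2]] exI[of _ n]) (simp add: algebra_simps)
qed

text \<open>This makes the propagator below measurable in the frequency. Division by zero gives 0,
  so the formula is total and the singular point \<kappa> = 0 needs no exception;
  \<open>cosh\<close> and \<open>sinh\<close> are unfolded to exponentials.\<close>

lemma borel_measurable_omega_eps [measurable]:
  "omega_eps grav \<rho>1 \<rho>2 h1 h2 \<epsilon> \<in> borel_measurable borel"
  unfolding omega_eps_def omega_def T_coeff_def coth_def cosh_def sinh_def
  by measurable

lemma L2_fun_diff:
  fixes u v :: "'a::euclidean_space \<Rightarrow> complex"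
  assumes "L2_fun u" "L2_fun v"
  shows "L2_fun (\<lambda>x. u x - v x)"
proof -
  have [measurable]: "u \<in> borel_measurable lebesgue" "v \<in> borel_measurable lebesgue"
    using assms by (auto simp: L2_fun_def)
  have "(cmod (u x - v x))\<^sup>2 \<le> 2 * (cmod (u x))\<^sup>2 + 2 * (cmod (v x))\<^sup>2" for x
  proof -
    have "(cmod (u x - v x))\<^sup>2 \<le> (cmod (u x) + cmod (v x))\<^sup>2"
      by (intro power_mono norm_triangle_ineq4) simp
    also have "\<dots> \<le> 2 * (cmod (u x))\<^sup>2 + 2 * (cmod (v x))\<^sup>2"
      using sum_squares_bound[of "cmod (u x)" "cmod (v x)"] by (simp add: power2_sum)
    finally show ?thesis .
  qed
  moreover have "integrable lebesgue (\<lambda>x. 2 * (cmod (u x))\<^sup>2 + 2 * (cmod (v x))\<^sup>2)"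
    using assms by (auto simp: L2_fun_def)
  ultimately have "integrable lebesgue (\<lambda>x. (cmod (u x - v x))\<^sup>2)"
    by (rule_tac Bochner_Integration.integrable_bound) auto
  then show ?thesis
    by (simp add: L2_fun_def)
qed

text \<open>The equation is required only off the origin, since \<open>v 0\<close> is unconstrained
  in the application; a null set does not change the integral. Elsewhere the constant modulus pulls
  out of the integral as \<open>r\<^sup>2\<close>.\<close>

lemma
  fixes u v :: "'a::euclidean_space \<Rightarrow> complex"
  assumes u: "L2_fun u"
    and a: "a \<in> borel_measurable lebesgue"
    and eq: "\<And>x. x \<noteq> 0 \<Longrightarrow> v x = a x * u x"
    and norm_a: "\<And>x. cmod (a x) = r"
  shows L2_fun_multiplier: "L2_fun v"
    and L2_norm_multiplier: "L2_norm v = r * L2_norm u"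
proof -
  note a [measurable]
  have [measurable]: "u \<in> borel_measurable lebesgue"
    using u by (simp add: L2_fun_def)
  \<comment> \<open>The almost-everywhere congruence rules used below ask for measurability of both
    sides. It holds because \<open>v\<close> is a measurable product altered at a single
    point.\<close>
  have "v = (\<lambda>x. if x \<in> {0} then v 0 else a x * u x)"
    using eq by auto
  also have "\<dots> \<in> borel_measurable lebesgue"
    by (intro measurable_If_set) auto
  finally have v [measurable]: "v \<in> borel_measurable lebesgue" .
  have ae: "AE x in lebesgue. (cmod (v x))\<^sup>2 = r\<^sup>2 * (cmod (u x))\<^sup>2"
  proof -
    have "AE x in lebesgue. x \<noteq> (0::'a)"
      by (intro AE_I[of _ _ "{0}"]) auto
    then show ?thesis
      by eventually_elim (simp add: eq norm_mult norm_a power_mult_distrib)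
  qed
  have "integrable lebesgue (\<lambda>x. r\<^sup>2 * (cmod (u x))\<^sup>2)"
    using u by (simp add: L2_fun_def)
  then show "L2_fun v"
    using integrable_cong_AE[OF _ _ ae] v by (simp add: L2_fun_def)
  \<comment> \<open>Being a value of \<open>cmod\<close> makes \<open>r\<close> nonnegative, so
    \<open>sqrt (r\<^sup>2)\<close> is \<open>r\<close> itself.\<close>
  have "0 \<le> r"
    using norm_a[of 0] by (metis norm_ge_zero)
  have "(\<integral>x. (cmod (v x))\<^sup>2 \<partial>lebesgue) = r\<^sup>2 * (\<integral>x. (cmod (u x))\<^sup>2 \<partial>lebesgue)"
    using integral_cong_AE[OF _ _ ae] by simp
  then show "L2_norm v = r * L2_norm u"
    using \<open>0 \<le> r\<close> by (simp add: L2_norm_def real_sqrt_mult)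
qed

theorem mainTheorem8:
  fixes \<rho>1 \<rho>2 h1 h2 grav \<epsilon> dt :: real
    and U :: "real \<Rightarrow> real ^ 'd"
    and f fhat :: "real ^ 'd \<Rightarrow> complex"
    and \<mu> :: "nat \<Rightarrow> real \<Rightarrow> real ^ 'd \<Rightarrow> complex"
    and \<nu> :: "nat \<Rightarrow> nat \<Rightarrow> real ^ 'd \<Rightarrow> complex"
    and Q :: "real ^ 'd \<Rightarrow> nat \<Rightarrow> (real \<Rightarrow> complex) \<Rightarrow> complex"
    and err :: "real \<Rightarrow> real ^ 'd \<Rightarrow> complex"
    and errd :: "nat \<Rightarrow> real ^ 'd \<Rightarrow> complex"
    and \<omega> :: "real ^ 'd \<Rightarrow> real"
    and \<omega>\<epsilon> :: "real ^ 'd \<Rightarrow> complex"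
    and src :: "real ^ 'd \<Rightarrow> real \<Rightarrow> complex"
  assumes dim: "CARD('d) = 1 \<or> CARD('d) = 2"
    and constants: "0 < \<rho>1" "\<rho>1 < \<rho>2" "0 < h1" "0 < h2" "0 < grav"
    and eps: "0 \<le> \<epsilon>"
    and step: "0 < dt"
    and velocity: "\<And>t. 0 \<le> t \<Longrightarrow> set_integrable lebesgue {0..t} U"
    and shape: "L2_fun f"
    and shape_hat: "is_L2_fourier f fhat"
    and \<omega>: "\<omega> = omega grav \<rho>1 \<rho>2 h1 h2"
    and \<omega>\<epsilon>: "\<omega>\<epsilon> = omega_eps grav \<rho>1 \<rho>2 h1 h2 \<epsilon>"
    and src: "src = source_hat \<rho>1 \<rho>2 h1 h2 U fhat"
    and initial: "\<And>m. m \<in> {1, 2} \<Longrightarrow> L2_fun (\<mu> m 0)"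
    and solution: "\<And>m t \<kappa>. m \<in> {1, 2} \<Longrightarrow> 0 \<le> t \<Longrightarrow> \<kappa> \<noteq> 0 \<Longrightarrow>
      \<mu> m t \<kappa> = \<mu> m 0 \<kappa> * exp (\<i> * \<omega>\<epsilon> \<kappa> * complex_of_real t)
        - set_lebesgue_integral lebesgue {0..t}
            (\<lambda>\<tau>. exp (\<i> * \<omega>\<epsilon> \<kappa> * complex_of_real (t - \<tau>)) * src \<kappa> \<tau>)"
    and err: "\<And>t \<kappa>. err t \<kappa> = \<mu> 1 t \<kappa> - \<mu> 2 t \<kappa>"
    and quadrature: "\<And>\<kappa> k. \<kappa> \<noteq> 0 \<Longrightarrow> quadrature_rule 0 dt (Q \<kappa> k)"
    and integrator_0: "\<And>m \<kappa>. m \<in> {1, 2} \<Longrightarrow> \<kappa> \<noteq> 0 \<Longrightarrow> \<nu> m 0 \<kappa> = \<mu> m 0 \<kappa>"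
    and integrator_Suc: "\<And>m k \<kappa>. m \<in> {1, 2} \<Longrightarrow> \<kappa> \<noteq> 0 \<Longrightarrow>
      \<nu> m (Suc k) \<kappa> = exp (\<i> * \<omega>\<epsilon> \<kappa> * complex_of_real dt) *
        (\<nu> m k \<kappa> - Q \<kappa> k (\<lambda>\<tau>. exp (- \<i> * \<omega>\<epsilon> \<kappa> * complex_of_real \<tau>) * src \<kappa> (\<tau> + real k * dt)))"
    and errd: "\<And>k \<kappa>. errd k \<kappa> = \<nu> 1 k \<kappa> - \<nu> 2 k \<kappa>"
  shows "(\<forall>t\<ge>0. \<forall>\<kappa>. \<kappa> \<noteq> 0 \<longrightarrow> err t \<kappa> = exp (\<i> * \<omega>\<epsilon> \<kappa> * complex_of_real t) * err 0 \<kappa>)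
    \<and> (\<forall>t\<ge>0. L2_fun (err t) \<and> L2_norm (err t) = exp (- \<epsilon> * t) * L2_norm (err 0))
    \<and> (0 < \<epsilon> \<longrightarrow> ((\<lambda>t. L2_norm (err t)) \<longlongrightarrow> 0) at_top)
    \<and> (\<forall>t\<ge>0. \<forall>\<kappa>. \<kappa> \<noteq> 0 \<longrightarrow> err 0 \<kappa> \<noteq> 0 \<longrightarrow>
          err t \<kappa> \<noteq> 0 \<and> [Arg (err t \<kappa>) = Arg (err 0 \<kappa>) + \<omega> \<kappa> * t] (rmod (2 * pi)))
    \<and> (\<forall>k \<kappa>. \<kappa> \<noteq> 0 \<longrightarrow> errd (Suc k) \<kappa> = exp (\<i> * \<omega>\<epsilon> \<kappa> * complex_of_real dt) * errd k \<kappa>)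
    \<and> (\<forall>k. L2_fun (errd k) \<and> L2_norm (errd k) = exp (- \<epsilon> * (real k * dt)) * L2_norm (err 0))
    \<and> (\<forall>k \<kappa>. \<kappa> \<noteq> 0 \<longrightarrow> err 0 \<kappa> \<noteq> 0 \<longrightarrow>
          errd k \<kappa> \<noteq> 0 \<and>
          [Arg (errd k \<kappa>) = Arg (err 0 \<kappa>) + \<omega> \<kappa> * (real k * dt)] (rmod (2 * pi)))
    \<and> (\<forall>k \<kappa>. \<kappa> \<noteq> 0 \<longrightarrow> errd k \<kappa> = err (real k * dt) \<kappa>)"
proof -
  define E where "E t \<kappa> = exp (\<i> * \<omega>\<epsilon> \<kappa> * complex_of_real t)" for t \<kappa>
  have E_measurable: "E t \<in> borel_measurable lebesgue" for t
    unfolding E_def[abs_def] \<omega>\<epsilon> by (rule measurable_completion) measurable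
  \<comment> \<open>As \<open>omega\<close> is real-valued for every \<kappa>, including 0, the
    exponent has real part \<open>- \<epsilon> * t\<close> and imaginary part
    \<open>\<omega> \<kappa> * t\<close>: the first gives the dissipation, the second the phase
    shift in \<open>Arg_E\<close>.\<close>
  have norm_E: "cmod (E t \<kappa>) = exp (- \<epsilon> * t)" for t \<kappa>
    by (simp add: E_def \<omega>\<epsilon> omega_eps_def)
  have Arg_E: "E t \<kappa> * z \<noteq> 0 \<and> [Arg (E t \<kappa> * z) = Arg z + \<omega> \<kappa> * t] (rmod (2 * pi))"
    if "z \<noteq> 0" for t \<kappa> z
    using rcong_Arg_exp_mult[OF that, of "\<i> * \<omega>\<epsilon> \<kappa> * complex_of_real t"] that
    by (simp add: E_def \<omega> \<omega>\<epsilon> omega_eps_def)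
  have err_evolution: "err t \<kappa> = E t \<kappa> * err 0 \<kappa>" if "0 \<le> t" "\<kappa> \<noteq> 0" for t \<kappa>
  proof -
    \<comment> \<open>The integral does not mention \<open>m\<close>; it enters only as one value
      common to both solutions.\<close>
    define I where "I = set_lebesgue_integral lebesgue {0..t}
      (\<lambda>\<tau>. exp (\<i> * \<omega>\<epsilon> \<kappa> * complex_of_real (t - \<tau>)) * src \<kappa> \<tau>)"
    have "\<mu> m t \<kappa> = \<mu> m 0 \<kappa> * E t \<kappa> - I" if "m \<in> {1, 2}" for m
      unfolding I_def E_def using solution that \<open>0 \<le> t\<close> \<open>\<kappa> \<noteq> 0\<close> by blast
    then show ?thesis
      by (simp add: err right_diff_distrib mult.commute)
  qed
  have errd_Suc: "errd (Suc k) \<kappa> = E dt \<kappa> * errd k \<kappa>" if "\<kappa> \<noteq> 0" for k \<kappa>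
  proof -
    \<comment> \<open>For both \<open>m\<close> the rule receives the same integrand, which does not
      involve \<nu>. Its values therefore agree even if \<open>Q \<kappa> k\<close> is nonlinear or
      changes with \<open>k\<close>.\<close>
    define q where
      "q = Q \<kappa> k (\<lambda>\<tau>. exp (- \<i> * \<omega>\<epsilon> \<kappa> * complex_of_real \<tau>) * src \<kappa> (\<tau> + real k * dt))"
    have "\<nu> m (Suc k) \<kappa> = E dt \<kappa> * (\<nu> m k \<kappa> - q)" if "m \<in> {1, 2}" for m
      unfolding q_def E_def using integrator_Suc that \<open>\<kappa> \<noteq> 0\<close> by blast
    then show ?thesis
      by (simp add: errd right_diff_distrib)
  qed
  \<comment> \<open>The factors \<open>E\<close> multiply as their times add, so \<open>k\<close>
    steps of length \<open>dt\<close> compose to the exact propagator at time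
    \<open>real k * dt\<close>.\<close>
  have errd_evolution: "errd k \<kappa> = E (real k * dt) \<kappa> * err 0 \<kappa>" if "\<kappa> \<noteq> 0" for k \<kappa>
  proof (induction k)
    case 0
    then show ?case
      using that by (simp add: errd err integrator_0 E_def)
  next
    case (Suc k)
    have "E dt \<kappa> * E (real k * dt) \<kappa> = E (real (Suc k) * dt) \<kappa>"
      by (simp add: E_def exp_add [symmetric] algebra_simps)
    then show ?case
      using Suc errd_Suc[OF that] by (simp add: mult.assoc [symmetric])
  qed
  have "err 0 = (\<lambda>\<kappa>. \<mu> 1 0 \<kappa> - \<mu> 2 0 \<kappa>)"
    using err by auto
  then have err_0: "L2_fun (err 0)"
    using L2_fun_diff initial by auto
  have norm_err: "L2_fun (err t)" "L2_norm (err t) = exp (- \<epsilon> * t) * L2_norm (err 0)"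
    if "0 \<le> t" for t
    using that L2_fun_multiplier[OF err_0 E_measurable err_evolution norm_E]
      L2_norm_multiplier[OF err_0 E_measurable err_evolution norm_E] by blast+
  have norm_errd: "L2_fun (errd k)"
    "L2_norm (errd k) = exp (- \<epsilon> * (real k * dt)) * L2_norm (err 0)" for k
    using L2_fun_multiplier[OF err_0 E_measurable errd_evolution norm_E]
      L2_norm_multiplier[OF err_0 E_measurable errd_evolution norm_E] by blast+
  \<comment> \<open>Strict positivity matters: for \<epsilon> = 0 the norm is conserved.\<close>
  have decay: "((\<lambda>t. L2_norm (err t)) \<longlongrightarrow> 0) at_top" if "0 < \<epsilon>"
  proof -
    have "filterlim (\<lambda>t. - \<epsilon> * t) at_bot at_top"
      using that by (intro filterlim_tendsto_neg_mult_at_bot[OF tendsto_const _ filterlim_ident]) auto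
    then have "((\<lambda>t. exp (- \<epsilon> * t)) \<longlongrightarrow> 0) at_top"
      by (rule filterlim_compose[OF exp_at_bot])
    then have "((\<lambda>t. exp (- \<epsilon> * t) * L2_norm (err 0)) \<longlongrightarrow> 0) at_top"
      by (rule tendsto_mult_left_zero)
    \<comment> \<open>The norm formula is available only for nonnegative times, hence the passage to
      an eventual equality.\<close>
    moreover have "\<forall>\<^sub>F t in at_top. exp (- \<epsilon> * t) * L2_norm (err 0) = L2_norm (err t)"
      using eventually_ge_at_top[of 0] by eventually_elim (rule norm_err(2)[symmetric])
    ultimately show ?thesis
      by (rule Lim_transform_eventually)
  qed
  have errd_eq_err: "errd k \<kappa> = err (real k * dt) \<kappa>" if "\<kappa> \<noteq> 0" for k \<kappa>
    using step that err_evolution[of "real k * dt" \<kappa>] errd_evolution[of \<kappa> k] by simp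
  \<comment> \<open>A zero error has no genuine phase, as \<open>Arg 0\<close> is 0 by convention. A
    nonzero initial component stays nonzero because the exponential never vanishes.\<close>
  have Arg_err: "err t \<kappa> \<noteq> 0 \<and> [Arg (err t \<kappa>) = Arg (err 0 \<kappa>) + \<omega> \<kappa> * t] (rmod (2 * pi))"
    if "0 \<le> t" "\<kappa> \<noteq> 0" "err 0 \<kappa> \<noteq> 0" for t \<kappa>
    using Arg_E[OF that(3), of t \<kappa>] unfolding err_evolution[OF that(1,2), symmetric] .
  have Arg_errd: "errd k \<kappa> \<noteq> 0 \<and>
      [Arg (errd k \<kappa>) = Arg (err 0 \<kappa>) + \<omega> \<kappa> * (real k * dt)] (rmod (2 * pi))"
    if "\<kappa> \<noteq> 0" "err 0 \<kappa> \<noteq> 0" for k \<kappa>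
    using Arg_E[OF that(2), of "real k * dt" \<kappa>] unfolding errd_evolution[OF that(1), symmetric] .
  show ?thesis
    unfolding E_def [symmetric]
    by (intro conjI allI impI)
      (fact norm_err norm_errd decay err_evolution errd_Suc errd_eq_err
        Arg_err[THEN conjunct1] Arg_err[THEN conjunct2]
        Arg_errd[THEN conjunct1] Arg_errd[THEN conjunct2])+
qed

end
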